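(* For every integer $k\geq 1$ there is a measurable $(k+3)$-coloring $f:\mathbb{R}\to\{1,2,\ldots,k+3\}$ of the real line such that no interval $[a,b]$ has a splitting of size at most $k$ with respect to $f$.
   Context: A measurable $m$-coloring of $\mathbb{R}$ is a map $f:\mathbb{R}\to\{1,\ldots,m\}$ such that each color class $f^{-1}(i)$ is Lebesgue measurable. For a measurable set $X$, the measure of color $i$ in $X$ is $\lambda(f^{-1}(i)\cap X)$, where $\lambda$ is Lebesgue measure. A splitting of size $r$ of an interval $[a,b]$ is a sequence of points $a=y_0<y_1<\cdots<y_r<y_{r+1}=b$ such that the collection of intervals $F=\{[y_i,y_{i+1}]:0\leq i\leq r\}$ can be partitioned into two disjoint subcollections $F_1,F_2$ such that, for every color $i$, the measure of color $i$ in the union of the members of $F_1$ equals the measure of color $i$ in the union of the members of $F_2$ (each is exactly half of the measure of color $i$ in $[a,b]$); such a partition is called a fair partition. *)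

theory Defs
  imports "HOL-Analysis.Analysis"
begin

definition measurable_coloring :: "nat \<Rightarrow> (real \<Rightarrow> nat) \<Rightarrow> bool" where
  "measurable_coloring m f \<longleftrightarrow>
     range f \<subseteq> {1..m} \<and> (\<forall>i\<in>{1..m}. f -` {i} \<in> sets lebesgue)"

definition color_measure :: "(real \<Rightarrow> nat) \<Rightarrow> nat \<Rightarrow> real set \<Rightarrow> real" where
  "color_measure f i X = measure lebesgue (f -` {i} \<inter> X)"

definition fair_partition ::
    "nat \<Rightarrow> (real \<Rightarrow> nat) \<Rightarrow> real set set \<Rightarrow> real set set \<Rightarrow> real set set \<Rightarrow> bool" where
  "fair_partition m f F F1 F2 \<longleftrightarrow>
     F1 \<union> F2 = F \<and> F1 \<inter> F2 = {} \<and>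
     (\<forall>i\<in>{1..m}. color_measure f i (\<Union>F1) = color_measure f i (\<Union>F2))"

text \<open>Only the values of \<open>y\<close> at \<open>0, \<dots>, r + 1\<close> matter.\<close>

definition is_splitting ::
    "nat \<Rightarrow> (real \<Rightarrow> nat) \<Rightarrow> real \<Rightarrow> real \<Rightarrow> nat \<Rightarrow> (nat \<Rightarrow> real) \<Rightarrow> bool" where
  "is_splitting m f a b r y \<longleftrightarrow>
     y 0 = a \<and> y (r + 1) = b \<and> (\<forall>i\<le>r. y i < y (i + 1)) \<and>
     (\<exists>F1 F2. fair_partition m f {{y i..y (i + 1)} |i. i \<le> r} F1 F2)"

definition has_splitting :: "nat \<Rightarrow> (real \<Rightarrow> nat) \<Rightarrow> real \<Rightarrow> real \<Rightarrow> nat \<Rightarrow> bool" where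
  "has_splitting m f a b r \<longleftrightarrow> (\<exists>y. is_splitting m f a b r y)"

end

theory Submission
  imports Defs
begin

text \<open>
  The coloring is a limit of step colorings: stage \<open>s\<close> recolors a tiny interval \<open>[u\<^sub>s, v\<^sub>s)\<close>, and the
  pairs of target interval and color run through a dense family. Let \<open>P\<close> be the finite set of
  breakpoints after \<open>n\<close> stages; it is kept linearly independent over the integers.

  A splitting of size at most \<open>k\<close> has at most \<open>k + 2\<close> endpoints, counting \<open>a\<close> and \<open>b\<close>, so some color
  \<open>i\<close> among the \<open>k + 3\<close> is the color of none of them. Hence no endpoint cuts a cell of color \<open>i\<close>, and
  the imbalance of color \<open>i\<close> is an integer combination of \<open>P\<close> with coefficients between \<open>-2\<close> and \<open>2\<close>;
  it is nontrivial as soon as color \<open>i\<close> occurs in \<open>[a, b]\<close>. Finitely many such combinations exist, so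
  the imbalance is bounded away from zero, and the interval lengths of the later stages are chosen
  too small to compensate for it.
\<close>

text \<open>\<open>g\<close> is constant on the cells cut out by \<open>P\<close>, each closed on the left and open on the right.\<close>

definition step_on :: "real set \<Rightarrow> (real \<Rightarrow> 'a) \<Rightarrow> bool" where
  "step_on P g \<longleftrightarrow> (\<forall>x y. (\<forall>p\<in>P. p \<le> x \<longleftrightarrow> p \<le> y) \<longrightarrow> g x = g y)"

text \<open>For finite \<open>P\<close> this amounts to linear independence over the rationals, by
  clearing denominators.\<close>

definition int_independent :: "real set \<Rightarrow> bool" where
  "int_independent P \<longleftrightarrow>
     (\<forall>d :: real \<Rightarrow> int. (\<Sum>p\<in>P. of_int (d p) * p) = 0 \<longrightarrow> (\<forall>p\<in>P. d p = 0))"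

text \<open>The bound 2 accommodates differences of two jump functions with values in -1, 0,
  1.\<close>

definition combination_gap :: "real set \<Rightarrow> real \<Rightarrow> bool" where
  "combination_gap P \<delta> \<longleftrightarrow>
     (\<forall>d :: real \<Rightarrow> int. (\<forall>p\<in>P. \<bar>d p\<bar> \<le> 2) \<longrightarrow> (\<exists>p\<in>P. d p \<noteq> 0) \<longrightarrow>
        \<delta> \<le> \<bar>\<Sum>p\<in>P. of_int (d p) * p\<bar>)"

section \<open>Step functions, their jumps, and the measure of step sets\<close>

lemma step_onD: "step_on P g \<Longrightarrow> (\<And>p. p \<in> P \<Longrightarrow> p \<le> x \<longleftrightarrow> p \<le> y) \<Longrightarrow> g x = g y"
  by (auto simp: step_on_def)

text \<open>\<open>d p\<close> is the jump of \<open>g\<close> at \<open>p\<close>. The induction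
  removes the largest breakpoint \<open>m\<close>: from \<open>m\<close> on, \<open>h\<close> keeps
  the value that \<open>g\<close> has just before \<open>m\<close>, so \<open>h\<close> is a step
  function for \<open>P\<close> and only the jump at \<open>m\<close> is missing.\<close>

lemma step_function_jumps:
  fixes g :: "real \<Rightarrow> int"
  assumes "finite P" "step_on P g" "\<And>x. g x \<in> {0, 1}" "\<And>x. (\<forall>p\<in>P. x < p) \<Longrightarrow> g x = 0"
  shows "\<exists>d. (\<forall>p. \<bar>d p\<bar> \<le> 1) \<and> (\<forall>x. g x = (\<Sum>p\<in>{p\<in>P. p \<le> x}. d p))"
  using assms
proof (induction P arbitrary: g rule: finite_linorder_max_induct)
  case empty
  then show ?case by (intro exI[of _ "\<lambda>_. 0"]) auto
next
  case (insert m P)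
  \<comment> \<open>\<open>z\<close> lies in the last cell before \<open>m\<close>; the entry
    \<open>m - 1\<close> serves the case of empty \<open>P\<close>.\<close>
  define z where "z = Max (insert (m - 1) P)"
  have z: "z < m" "\<And>p. p \<in> P \<Longrightarrow> p \<le> z"
    using insert.hyps by (auto simp: z_def)
  define h where "h x = (if x < m then g x else g z)" for x
  have "step_on P h"
    unfolding step_on_def
  proof (intro allI impI)
    fix x y assume xy: "\<forall>p\<in>P. (p \<le> x) = (p \<le> y)"
    have *: "g x = g z" if "x < m" "y \<ge> m" "\<forall>p\<in>P. (p \<le> x) = (p \<le> y)" for x y
      using that z insert.hyps(2) by (intro step_onD[OF insert.prems(1)]) force
    have **: "g x = g y" if "x < m" "y < m"
      using xy that by (intro step_onD[OF insert.prems(1)]) auto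
    show "h x = h y"
      using *[of x y] *[of y x] ** xy unfolding h_def by (auto simp: not_less)
  qed
  moreover have "h x \<in> {0, 1}" for x
    using insert.prems(2) by (auto simp: h_def)
  moreover have "h x = 0" if "\<forall>p\<in>P. x < p" for x
  proof (cases "x < m")
    case True
    then show ?thesis using that insert.prems(3) by (auto simp: h_def)
  next
    case False
    then have "P = {}"
      using that insert.hyps(2) by fastforce
    then show ?thesis
      using False z(1) insert.prems(3)[of z] by (auto simp: h_def)
  qed
  ultimately obtain d where d: "\<And>p. \<bar>d p\<bar> \<le> 1" "\<And>x. h x = (\<Sum>p\<in>{p\<in>P. p \<le> x}. d p)"
    using insert.IH[of h] by blast
  define e where "e = d(m := g m - g z)"
  have "m \<notin> P" using insert.hyps(2) by auto
  have "\<bar>e p\<bar> \<le> 1" for p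
    using d(1)[of p] insert.prems(2)[of m] insert.prems(2)[of z] by (auto simp: e_def)
  moreover have "g x = (\<Sum>p\<in>{p\<in>insert m P. p \<le> x}. e p)" for x
  proof -
    have de: "(\<Sum>p\<in>{p\<in>P. p \<le> x}. e p) = h x"
      unfolding d(2) using \<open>m \<notin> P\<close> by (intro sum.cong) (auto simp: e_def)
    show ?thesis
    proof (cases "x < m")
      case True
      then have "{p\<in>insert m P. p \<le> x} = {p\<in>P. p \<le> x}" by auto
      then show ?thesis using de True by (simp add: h_def)
    next
      case False
      then have "{p\<in>insert m P. p \<le> x} = insert m {p\<in>P. p \<le> x}" by auto
      then have "(\<Sum>p\<in>{p\<in>insert m P. p \<le> x}. e p) = e m + h x"
        using de \<open>m \<notin> P\<close> insert.hyps(1) by simp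
      also have "\<dots> = g m"
        using False by (simp add: e_def h_def)
      also have "\<dots> = g x"
        using False insert.hyps(2) by (intro step_onD[OF insert.prems(1)]) force
      finally show ?thesis by simp
    qed
  qed
  ultimately show ?case by blast
qed

text \<open>The indicator of \<open>A\<close> is the combination, with the jumps \<open>d p\<close>
  as coefficients, of the indicators of \<open>{p..<B}\<close> for a large \<open>B\<close>. On
  integrating, the terms in \<open>B\<close> cancel because the jumps add up to zero. Recovering
  \<open>A\<close> from \<open>d\<close> later serves to tell two such sets apart.\<close>

lemma step_set_measure:
  fixes A :: "real set"
  assumes P: "finite P" and step: "step_on P (\<lambda>x. x \<in> A)" and "bounded A"
  obtains d :: "real \<Rightarrow> int"
  where "\<And>p. \<bar>d p\<bar> \<le> 1" "\<And>x. x \<in> A \<longleftrightarrow> (\<Sum>p\<in>{p\<in>P. p \<le> x}. d p) = 1"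
    "A \<in> lmeasurable" "measure lebesgue A = - (\<Sum>p\<in>P. of_int (d p) * p)"
proof -
  obtain B where B: "\<And>x. x \<in> A \<Longrightarrow> \<bar>x\<bar> < B" "\<And>x. x \<in> P \<Longrightarrow> \<bar>x\<bar> < B"
  proof -
    have "bounded (A \<union> P)" using assms finite_imp_bounded by auto
    then obtain B where "\<And>x. x \<in> A \<union> P \<Longrightarrow> norm x < B"
      by (metis bounded_pos_less)
    then show ?thesis using that by auto
  qed
  define g :: "real \<Rightarrow> int" where "g x = (if x \<in> A then 1 else 0)" for x
  have stg: "step_on P g"
    using step unfolding step_on_def g_def by metis
  have g0: "g x = 0" if "\<forall>p\<in>P. x < p" for x
  proof -
    \<comment> \<open>Left of all breakpoints there is a single cell; it contains points at or below
      \<open>- B\<close>, which are outside \<open>A\<close>.\<close>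
    have "g x = g (min x (- B))"
      using that by (intro step_onD[OF stg]) force
    also have "\<dots> = 0" using B(1)[of "min x (- B)"] by (auto simp: g_def)
    finally show ?thesis .
  qed
  obtain d where d: "\<And>p. \<bar>d p\<bar> \<le> 1" "\<And>x. g x = (\<Sum>p\<in>{p\<in>P. p \<le> x}. d p)"
    using step_function_jumps[OF P stg _ g0] by (metis g_def insertCI)
  \<comment> \<open>At \<open>B\<close> every breakpoint has been passed and \<open>g\<close> is
    back at zero.\<close>
  have sum0: "(\<Sum>p\<in>P. d p) = 0"
  proof -
    have "P = {p\<in>P. p \<le> B}" using B(2) by force
    then show ?thesis using d(2)[of B] B(1)[of B] by (force simp: g_def)
  qed
  have ind: "indicator A x = (\<Sum>p\<in>P. of_int (d p) * indicator {p..<B} x :: real)" for x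
  proof (cases "x < B")
    case True
    have "(indicator A x :: real) = of_int (g x)" by (simp add: g_def indicator_def)
    also have "\<dots> = (\<Sum>p\<in>{p\<in>P. p \<le> x}. of_int (d p))" by (simp add: d(2))
    also have "\<dots> = (\<Sum>p\<in>P. of_int (d p) * indicator {p..<B} x)"
      using P True by (intro sum.mono_neutral_cong_left) (auto simp: indicator_def)
    finally show ?thesis .
  next
    case False
    then show ?thesis using B(1)[of x] by (force simp: indicator_def)
  qed
  have "A = (\<lambda>x. \<Sum>p\<in>P. of_int (d p) * indicator {p..<B} x :: real) -` {1} \<inter> space borel"
    unfolding ind[symmetric] by (auto simp: indicator_def)
  also have "\<dots> \<in> sets borel"
    by (intro measurable_sets[of _ borel borel]) auto
  finally have Ab: "A \<in> sets borel" .
  then have Al: "A \<in> lmeasurable"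
    using \<open>bounded A\<close> by (intro bounded_set_imp_lmeasurable) auto
  have "measure lebesgue A = integral\<^sup>L lebesgue (indicator A :: real \<Rightarrow> real)"
    using Al by simp
  also have "\<dots> = integral\<^sup>L lebesgue (\<lambda>x. \<Sum>p\<in>P. of_int (d p) * indicator {p..<B} x :: real)"
    by (intro Bochner_Integration.integral_cong refl ind)
  also have "\<dots> = (\<Sum>p\<in>P. integral\<^sup>L lebesgue (\<lambda>x. of_int (d p) * indicator {p..<B} x :: real))"
    using B(2)
    by (intro Bochner_Integration.integral_sum integrable_mult_right integrable_real_indicator)
      (auto simp: abs_less_iff less_imp_le)
  also have "\<dots> = (\<Sum>p\<in>P. of_int (d p) * (B - p))"
    using B(2) by (intro sum.cong) (auto simp: abs_less_iff less_imp_le)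
  also have "\<dots> = of_int (\<Sum>p\<in>P. d p) * B - (\<Sum>p\<in>P. of_int (d p) * p)"
    by (simp add: algebra_simps sum_subtractf sum_distrib_left)
  finally have "measure lebesgue A = - (\<Sum>p\<in>P. of_int (d p) * p)"
    using sum0 by simp
  moreover have "x \<in> A \<longleftrightarrow> (\<Sum>p\<in>{p\<in>P. p \<le> x}. d p) = 1" for x
    by (simp add: d(2)[symmetric] g_def)
  ultimately show ?thesis using that d(1) Al by blast
qed

section \<open>Imbalance of a color carried by no endpoint\<close>

text \<open>An endpoint between two points of one cell would belong to that cell and have its color.
  So a cell of color \<open>i\<close> lies on one side of each endpoint, and membership in the
  intervals is constant on it.\<close>

lemma step_on_color_in_intervals:
  assumes f: "step_on P f" and F: "\<And>I. I \<in> F \<Longrightarrow> \<exists>u\<in>Y. \<exists>v\<in>Y. I = {u..v}" and i: "i \<notin> f ` Y"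
  shows "step_on P (\<lambda>x. x \<in> f -` {i} \<inter> \<Union>F)"
proof -
  have *: "x' \<in> f -` {i} \<inter> \<Union>F"
    if xx': "\<forall>p\<in>P. p \<le> x \<longleftrightarrow> p \<le> x'" and x: "x \<in> f -` {i} \<inter> \<Union>F" for x x'
  proof -
    obtain u v where uv: "u \<in> Y" "v \<in> Y" "{u..v} \<in> F" "u \<le> x" "x \<le> v"
      using x F by fastforce
    have "f x' = i"
      using step_onD[OF f, of x x'] xx' x by auto
    have no: "\<not> (min x x' \<le> t \<and> t \<le> max x x')" if "t \<in> Y" for t
    proof
      assume "min x x' \<le> t \<and> t \<le> max x x'"
      then have "f t = f x"
        using xx' by (intro step_onD[OF f]) (force simp: min_def max_def split: if_splits)
      then show False using i that x by auto
    qed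
    have "u \<le> x'" "x' \<le> v"
      using no[OF uv(1)] no[OF uv(2)] uv by auto
    then show ?thesis using uv(3) \<open>f x' = i\<close> by (intro IntI UnionI[of "{u..v}"]) auto
  qed
  show ?thesis
    unfolding step_on_def
  proof (intro allI impI)
    fix x x' assume "\<forall>p\<in>P. p \<le> x \<longleftrightarrow> p \<le> x'"
    then show "(x \<in> f -` {i} \<inter> \<Union>F) = (x' \<in> f -` {i} \<inter> \<Union>F)"
      using *[of x x'] *[of x' x] by blast
  qed
qed

text \<open>Both measures are combinations of \<open>P\<close> with coefficients in -1, 0, 1, so the
  gap applies to their difference once that is nontrivial. The point \<open>x\<close>, lying in just
  one of the two unions, ensures this.\<close>

lemma imbalance_lower_bound:
  assumes P: "finite P" "step_on P f"
    and gap: "combination_gap P \<delta>"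
    and Y: "finite Y" "\<And>I. I \<in> F1 \<union> F2 \<Longrightarrow> \<exists>u\<in>Y. \<exists>v\<in>Y. I = {u..v}"
    and i: "i \<notin> f ` Y" and x: "f x = i" "x \<in> \<Union>F1 \<longleftrightarrow> x \<notin> \<Union>F2"
  shows "\<delta> \<le> \<bar>color_measure f i (\<Union>F1) - color_measure f i (\<Union>F2)\<bar>"
proof -
  obtain B where B: "\<And>y. y \<in> Y \<Longrightarrow> \<bar>y\<bar> \<le> B"
    using finite_imp_bounded[OF Y(1)] by (auto simp: bounded_iff)
  have bdd: "bounded (f -` {i} \<inter> \<Union>F)" if F: "F \<subseteq> F1 \<union> F2" for F
  proof (rule bounded_subset)
    show "bounded {-B..B}" by simp
    show "f -` {i} \<inter> \<Union>F \<subseteq> {-B..B}"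
    proof
      fix z assume "z \<in> f -` {i} \<inter> \<Union>F"
      then obtain u v where "u \<in> Y" "v \<in> Y" "u \<le> z" "z \<le> v"
        using F Y(2) by fastforce
      then show "z \<in> {-B..B}" using B[of u] B[of v] by auto
    qed
  qed
  have step: "step_on P (\<lambda>x. x \<in> f -` {i} \<inter> \<Union>F)" if "F \<subseteq> F1 \<union> F2" for F
    using that by (intro step_on_color_in_intervals[OF P(2) _ i] Y(2)) auto
  obtain d1 where d1: "\<And>p. \<bar>d1 p\<bar> \<le> 1"
      "\<And>x. x \<in> f -` {i} \<inter> \<Union>F1 \<longleftrightarrow> (\<Sum>p\<in>{p\<in>P. p \<le> x}. d1 p) = (1::int)"
      "f -` {i} \<inter> \<Union>F1 \<in> lmeasurable"
      "measure lebesgue (f -` {i} \<inter> \<Union>F1) = - (\<Sum>p\<in>P. of_int (d1 p) * p)"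
    using step_set_measure[OF P(1) step[of F1] bdd[of F1]] by blast
  obtain d2 where d2: "\<And>p. \<bar>d2 p\<bar> \<le> 1"
      "\<And>x. x \<in> f -` {i} \<inter> \<Union>F2 \<longleftrightarrow> (\<Sum>p\<in>{p\<in>P. p \<le> x}. d2 p) = (1::int)"
      "f -` {i} \<inter> \<Union>F2 \<in> lmeasurable"
      "measure lebesgue (f -` {i} \<inter> \<Union>F2) = - (\<Sum>p\<in>P. of_int (d2 p) * p)"
    using step_set_measure[OF P(1) step[of F2] bdd[of F2]] by blast
  \<comment> \<open>Equal jumps would give equal partial sums up to \<open>x\<close>, placing
    \<open>x\<close> in both sets or in neither.\<close>
  have "\<exists>p\<in>P. d2 p - d1 p \<noteq> 0"
  proof (rule ccontr)
    assume "\<not> ?thesis"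
    then have "(\<Sum>p\<in>{p\<in>P. p \<le> x}. d1 p) = (\<Sum>p\<in>{p\<in>P. p \<le> x}. d2 p)"
      by (intro sum.cong) auto
    then show False using d1(2)[of x] d2(2)[of x] x by auto
  qed
  moreover have "\<bar>d2 p - d1 p\<bar> \<le> 2" for p
    using d1(1)[of p] d2(1)[of p] by linarith
  ultimately have "\<delta> \<le> \<bar>\<Sum>p\<in>P. of_int (d2 p - d1 p) * p\<bar>"
    using gap[unfolded combination_gap_def, rule_format, of "\<lambda>p. d2 p - d1 p"] by simp
  also have "(\<Sum>p\<in>P. of_int (d2 p - d1 p) * p) =
      color_measure f i (\<Union>F1) - color_measure f i (\<Union>F2)"
    unfolding color_measure_def d1(4) d2(4) by (simp add: algebra_simps sum_subtractf)
  finally show ?thesis .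
qed

section \<open>Choice of breakpoints independent over the integers\<close>

text \<open>The points to avoid are those of \<open>P\<close> and its rational combinations; these
  are countably many, while the interval is uncountable.\<close>

lemma int_independent_insert:
  assumes "finite P" "int_independent P" "\<alpha> < \<beta>"
  obtains q where "\<alpha> < q" "q < \<beta>" "q \<notin> P" "int_independent (insert q P)"
proof -
  \<comment> \<open>\<open>PiE\<close> records only the values on \<open>P\<close>; the set of all
    functions from the reals to the integers is uncountable.\<close>
  define D where "D = (\<lambda>(d :: real \<Rightarrow> int, n :: int). (\<Sum>p\<in>P. of_int (d p) * p) / of_int n) `
    ((P \<rightarrow>\<^sub>E UNIV) \<times> UNIV)"
  have "countable (D \<union> P)"
    unfolding D_def
    by (intro countable_Un countable_image countable_SIGMA countable_PiE assms(1)
        countable_finite[OF assms(1)] countableI_type)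
  then have "\<not> {\<alpha><..<\<beta>} \<subseteq> D \<union> P"
    using uncountable_open_interval[of \<alpha> \<beta>] assms(3) countable_subset by metis
  then obtain q where q: "q \<in> {\<alpha><..<\<beta>}" "q \<notin> D \<union> P"
    by blast
  have "int_independent (insert q P)"
    unfolding int_independent_def
  proof (intro allI impI)
    fix d :: "real \<Rightarrow> int"
    assume "(\<Sum>p\<in>insert q P. of_int (d p) * p) = 0"
    then have eq: "of_int (d q) * q + (\<Sum>p\<in>P. of_int (d p) * p) = 0"
      using q assms(1) by simp
    have "d q = 0"
    proof (rule ccontr)
      assume "d q \<noteq> 0"
      then have "q = (\<Sum>p\<in>P. of_int (restrict d P p) * p) / of_int (- d q)"
        using eq by (simp add: field_simps)
      then have "q \<in> D"
        unfolding D_def by (intro image_eqI[of _ _ "(restrict d P, - d q)"]) auto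
      then show False using q by simp
    qed
    then show "\<forall>p\<in>insert q P. d p = 0"
      using eq assms(2) by (simp add: int_independent_def)
  qed
  then show ?thesis using q that by auto
qed

lemma int_independent_gap:
  assumes "finite P" "int_independent P"
  obtains \<delta> where "\<delta> > 0" "combination_gap P \<delta>"
proof -
  define D where "D = (\<lambda>d :: real \<Rightarrow> int. \<bar>\<Sum>p\<in>P. of_int (d p) * p\<bar>) ` (P \<rightarrow>\<^sub>E {-2..2}) - {0}"
  have fin: "finite D"
    unfolding D_def using assms(1) by (intro finite_Diff finite_imageI finite_PiE) auto
  \<comment> \<open>The extra 1 keeps the minimum meaningful when \<open>D\<close> is empty, as for
    empty \<open>P\<close>.\<close>
  show ?thesis
  proof (rule that[of "Min (insert 1 D)"])
    show "Min (insert 1 D) > 0"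
      using fin by (subst Min_gr_iff) (auto simp: D_def)
  next
    show "combination_gap P (Min (insert 1 D))"
      unfolding combination_gap_def
    proof (intro allI impI)
      fix d :: "real \<Rightarrow> int"
      assume d: "\<forall>p\<in>P. \<bar>d p\<bar> \<le> 2" "\<exists>p\<in>P. d p \<noteq> 0"
      then have "restrict d P \<in> P \<rightarrow>\<^sub>E {-2..2}"
        by (auto simp: restrict_PiE_iff abs_le_iff)
      then have "\<bar>\<Sum>p\<in>P. of_int (restrict d P p) * p\<bar> \<in> insert 0 D"
        unfolding D_def by blast
      moreover have "(\<Sum>p\<in>P. of_int (d p) * p) \<noteq> 0"
        using d(2) assms(2) by (auto simp: int_independent_def)
      ultimately have "\<bar>\<Sum>p\<in>P. of_int (d p) * p\<bar> \<in> D" by simp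
      then show "Min (insert 1 D) \<le> \<bar>\<Sum>p\<in>P. of_int (d p) * p\<bar>"
        using fin by (intro Min_le) auto
    qed
  qed
qed

text \<open>The gap of \<open>P n\<close> is known before \<open>u n\<close> and \<open>v n\<close>
  are picked, so the new interval can be as short as it demands. The factor 4 leaves room for an
  error below twice the length in each of two color measures; the ratio 1/4 keeps the total of the
  later lengths small.\<close>

lemma breakpoint_sequence:
  fixes \<alpha> \<beta> :: "nat \<Rightarrow> real"
  assumes "\<And>n. \<alpha> n < \<beta> n"
  obtains P :: "nat \<Rightarrow> real set" and u v :: "nat \<Rightarrow> real" where
    "\<And>n. finite (P n)" "\<And>n. \<alpha> n < u n" "\<And>n. u n < v n" "\<And>n. v n < \<beta> n"
    "\<And>n. P (Suc n) = P n \<union> {u n, v n}" "\<And>n. v (Suc n) - u (Suc n) \<le> (v n - u n) / 4"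
    "\<And>n. combination_gap (P n) (4 * (v n - u n))"
proof -
  \<comment> \<open>Independence is demanded with \<open>u\<close> and \<open>v\<close> already
    included, since that union is the next breakpoint set.\<close>
  define inv where "inv n = (\<lambda>(P, u, v).
      finite P \<and> int_independent (P \<union> {u, v}) \<and> \<alpha> n < u \<and> u < v \<and> v < \<beta> n \<and>
      combination_gap P (4 * (v - u)))" for n
  have extend: "\<exists>u v. inv n (P, u, v) \<and> v - u \<le> \<eta>"
    if P: "finite P" "int_independent P" and "\<eta> > 0" for n P \<eta>
  proof -
    obtain \<delta> where \<delta>: "\<delta> > 0" "combination_gap P \<delta>"
      using int_independent_gap[OF P] by blast
    obtain u where u: "\<alpha> n < u" "u < \<beta> n" "int_independent (insert u P)"
      using int_independent_insert[OF P assms[of n]] by blast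
    \<comment> \<open>The cap \<open>u + \<delta> / 4\<close> turns the gap \<open>\<delta>\<close>
      into \<open>4 * (v - u)\<close>; the cap \<open>u + \<eta>\<close> yields the decay.\<close>
    obtain v where v: "u < v" "v < min (\<beta> n) (min (u + \<eta>) (u + \<delta> / 4))"
        "int_independent (insert v (insert u P))"
      using int_independent_insert[of "insert u P" u "min (\<beta> n) (min (u + \<eta>) (u + \<delta> / 4))"]
        P u \<open>\<eta> > 0\<close> \<delta>(1) by auto
    have "4 * (v - u) \<le> \<delta>" using v(2) by simp
    then have "combination_gap P (4 * (v - u))"
      using \<delta>(2) unfolding combination_gap_def by (meson order_trans)
    then have "inv n (P, u, v)"
      using P u v unfolding inv_def by (simp add: insert_commute)
    then show ?thesis using v(2) by force
  qed
  define succ where "succ = (\<lambda>(P, u, v) (P', u', v').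
      P' = P \<union> {u, v} \<and> v' - u' \<le> (v - u) / (4 :: real))"
  have "\<exists>f. \<forall>n. inv n (f n) \<and> succ (f n) (f (Suc n))"
  proof (rule dependent_nat_choice)
    have "int_independent {}" by (simp add: int_independent_def)
    \<comment> \<open>The first stage has no predecessor, so its length bound is an arbitrary
      positive number, here 1.\<close>
    then show "\<exists>x. inv 0 x" using extend[of "{}" 1 0] by auto
  next
    fix x n assume "inv n x"
    moreover obtain P u v where x: "x = (P, u, v)" by (cases x)
    ultimately have "finite (P \<union> {u, v})" "int_independent (P \<union> {u, v})" "(v - u) / 4 > 0"
      by (auto simp: inv_def)
    from extend[OF this, of "Suc n"] show "\<exists>y. inv (Suc n) y \<and> succ x y"
      unfolding x succ_def by auto
  qed
  then obtain f where "\<And>n. inv n (f n)" "\<And>n. succ (f n) (f (Suc n))" by blast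
  note f = this[unfolded inv_def succ_def split_def]
  show ?thesis
  proof (rule that[of "\<lambda>n. fst (f n)" "\<lambda>n. fst (snd (f n))" "\<lambda>n. snd (snd (f n))"])
    show "fst (f (Suc n)) = fst (f n) \<union> {fst (snd (f n)), snd (snd (f n))}" for n
      using f(2)[of n] by blast
    show "snd (snd (f (Suc n))) - fst (snd (f (Suc n))) \<le> (snd (snd (f n)) - fst (snd (f n))) / 4" for n
      using f(2)[of n] by blast
    show "combination_gap (fst (f n)) (4 * (snd (snd (f n)) - fst (snd (f n))))" for n
      using f(1)[of n] by blast
  qed (simp_all add: f)
qed

section \<open>The limit coloring and its measurability\<close>

text \<open>Points in no \<open>J s\<close> and points in infinitely many of them get color \<open>1\<close>.\<close>

definition last_color :: "(nat \<Rightarrow> real set) \<Rightarrow> (nat \<Rightarrow> nat) \<Rightarrow> real \<Rightarrow> nat" where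
  "last_color J c x =
     (if \<exists>s. x \<in> J s \<and> (\<forall>t>s. x \<notin> J t) then c (THE s. x \<in> J s \<and> (\<forall>t>s. x \<notin> J t)) else 1)"

lemma last_color_eq:
  assumes "x \<in> J s" "\<And>t. t > s \<Longrightarrow> x \<notin> J t"
  shows "last_color J c x = c s"
proof -
  have "(THE s. x \<in> J s \<and> (\<forall>t>s. x \<notin> J t)) = s"
    using assms by (intro the_equality) (auto dest: linorder_neqE_nat)
  then show ?thesis using assms by (auto simp: last_color_def)
qed

lemma last_color_cong:
  assumes "\<And>s. x \<in> J s \<longleftrightarrow> y \<in> K s"
  shows "last_color J c x = last_color K c y"
  by (simp only: last_color_def assms)

lemma last_color_default: "\<not> (\<exists>s. x \<in> J s \<and> (\<forall>t>s. x \<notin> J t)) \<Longrightarrow> last_color J c x = 1"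
  by (auto simp: last_color_def)

lemma measurable_coloring_last_color:
  assumes J: "\<And>s. J s \<in> sets lebesgue" and c: "\<And>s. c s \<in> {1..m}" and "m \<ge> 1"
  shows "measurable_coloring m (last_color J c)"
proof -
  \<comment> \<open>\<open>L s\<close> collects the points last recolored at stage \<open>s\<close>.
    Each color class is a countable union of such sets, plus the complement of them all for color
    1.\<close>
  define L where "L s = J s - (\<Union>t\<in>{s<..}. J t)" for s
  have L: "L s \<in> sets lebesgue" for s
    unfolding L_def using J by (intro sets.Diff sets.countable_UN') auto
  have LI: "last_color J c x = c s" if "x \<in> L s" for x s
    using that by (intro last_color_eq) (auto simp: L_def)
  have L0: "last_color J c x = 1" if "x \<notin> (\<Union>s. L s)" for x
    using that by (intro last_color_default) (auto simp: L_def)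
  have "last_color J c x \<in> {1..m}" for x
  proof (cases "x \<in> (\<Union>s. L s)")
    case True
    then obtain s where "x \<in> L s" by blast
    then show ?thesis using LI[of x s] c[of s] by simp
  qed (use L0[of x] \<open>m \<ge> 1\<close> in auto)
  moreover have "last_color J c -` {i} \<in> sets lebesgue" for i
  proof -
    have "last_color J c -` {i} = (\<Union>s\<in>{s. c s = i}. L s) \<union> (if i = 1 then UNIV - (\<Union>s. L s) else {})"
    proof (rule set_eqI)
      fix x
      show "x \<in> last_color J c -` {i} \<longleftrightarrow>
          x \<in> (\<Union>s\<in>{s. c s = i}. L s) \<union> (if i = 1 then UNIV - (\<Union>s. L s) else {})"
      proof (cases "x \<in> (\<Union>s. L s)")
        case True
        then obtain s where s: "x \<in> L s" by blast
        have "last_color J c x = i" if "x \<in> (\<Union>s\<in>{s. c s = i}. L s)"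
        proof -
          from that obtain t where t: "x \<in> L t" "c t = i" by auto
          then show ?thesis using LI[OF t(1)] by simp
        qed
        moreover have "x \<in> (\<Union>s\<in>{s. c s = i}. L s)" if "last_color J c x = i"
          using that LI[OF s] s by (intro UN_I[of s]) simp_all
        ultimately show ?thesis using True by auto
      qed (use L0[of x] in auto)
    qed
    moreover have "(\<Union>s\<in>A. L s) \<in> sets lebesgue" for A
      using L by (intro sets.countable_UN') auto
    moreover have "UNIV - (\<Union>s. L s) \<in> sets lebesgue"
      using L by (intro sets.Diff sets.countable_UN') auto
    ultimately show ?thesis by auto
  qed
  ultimately show ?thesis by (auto simp: measurable_coloring_def)
qed

section \<open>Measure of the later stages\<close>

lemma geometric_tail_measure:
  fixes u v :: "nat \<Rightarrow> real"
  assumes uv: "\<And>n. u n < v n" and decay: "\<And>n. v (Suc n) - u (Suc n) \<le> (v n - u n) / 4"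
  shows "(\<Union>t\<in>{n..}. {u t..<v t}) \<in> lmeasurable"
    and "measure lebesgue (\<Union>t\<in>{n..}. {u t..<v t}) \<le> 4 / 3 * (v n - u n)"
proof -
  let ?J = "\<lambda>k. {u (n + k)..<v (n + k)}"
  have J: "?J k \<in> lmeasurable" for k
    by (intro bounded_set_imp_lmeasurable) auto
  have "measure lebesgue (\<Union>k\<le>N. ?J k) \<le> 4 / 3 * (v n - u n)" for N
  proof -
    have "measure lebesgue (\<Union>k\<le>N. ?J k) \<le> (\<Sum>k\<le>N. measure lebesgue (?J k))"
      using J by (intro measure_UNION_le) auto
    also have "\<dots> = (\<Sum>k\<le>N. v (n + k) - u (n + k))"
      using uv by (intro sum.cong) (auto simp: less_imp_le)
    \<comment> \<open>Subtracting a third of the last length makes the induction close, as each new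
      length is at most a quarter of the previous one.\<close>
    also have "\<dots> \<le> 4 / 3 * (v n - u n) - (v (n + N) - u (n + N)) / 3"
    proof (induction N)
      case 0
      show ?case by (simp add: field_simps)
    next
      case (Suc N)
      then show ?case using decay[of "n + N"] by (simp add: field_simps)
    qed
    also have "\<dots> \<le> 4 / 3 * (v n - u n)"
      using uv[of "n + N"] by (subst diff_le_eq) (simp add: less_imp_le)
    finally show ?thesis .
  qed
  note * = fmeasurable_countable_Union[of ?J lebesgue, OF J this]
    measure_countable_Union_le[of ?J lebesgue, OF J this]
  have "{n..} = range (\<lambda>k. n + k)"
    by (auto simp: le_iff_add)
  then have "(\<Union>t\<in>{n..}. {u t..<v t}) = (\<Union>k. ?J k)"
    by (simp add: image_image)
  then show "(\<Union>t\<in>{n..}. {u t..<v t}) \<in> lmeasurable"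
    "measure lebesgue (\<Union>t\<in>{n..}. {u t..<v t}) \<le> 4 / 3 * (v n - u n)"
    using * by simp_all
qed

lemma measure_diff_le_of_eq_off:
  assumes "A \<in> lmeasurable" "B \<in> lmeasurable" "E \<in> lmeasurable" "A - E = B - E"
  shows "\<bar>measure lebesgue A - measure lebesgue B\<bar> \<le> measure lebesgue E"
proof -
  have *: "measure lebesgue A - measure lebesgue B \<le> measure lebesgue E"
    if "A \<in> lmeasurable" "B \<in> lmeasurable" "A - E = B - E" for A B
  proof -
    have "measure lebesgue A - measure lebesgue B \<le> measure lebesgue (A - B)"
      using that by (intro measure_diff_le_measure_setdiff)
    also have "\<dots> \<le> measure lebesgue E"
      using that assms(3) by (intro measure_mono_fmeasurable) (auto simp: fmeasurableD)
    finally show ?thesis .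
  qed
  show ?thesis using *[of A B] *[of B A] assms by auto
qed

lemma point_in_consecutive:
  fixes y :: "nat \<Rightarrow> real"
  assumes "y 0 \<le> x" "x \<le> y (Suc n)"
  shows "\<exists>p\<le>n. y p \<le> x \<and> x \<le> y (Suc p)"
  using assms(2)
proof (induction n)
  case 0
  then show ?case using assms(1) by auto
next
  case (Suc n)
  then show ?case by (cases "x \<le> y (Suc n)") (auto intro: le_SucI)
qed

section \<open>Construction of the coloring and refutation of short splittings\<close>

theorem theorem1:
  fixes k :: nat
  assumes "k \<ge> 1"
  shows "\<exists>f :: real \<Rightarrow> nat. measurable_coloring (k + 3) f \<and>
           (\<forall>a b :: real. a < b \<longrightarrow> \<not> (\<exists>r\<le>k. has_splitting (k + 3) f a b r))"
proof -
  \<comment> \<open>Every interval contains one with rational ends, so countably many targets place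
    every color in every interval.\<close>
  define T where "T = {(\<alpha> :: real, \<beta>, c). \<alpha> \<in> \<rat> \<and> \<beta> \<in> \<rat> \<and> \<alpha> < \<beta> \<and> c \<in> {1..k + 3}}"
  have "T \<subseteq> \<rat> \<times> \<rat> \<times> {1..k + 3}" by (auto simp: T_def)
  then have "countable T"
    by (rule countable_subset) (intro countable_SIGMA countable_rat countableI_type)
  moreover have "(0, 1, 1) \<in> T" by (simp add: T_def)
  ultimately have T: "range (from_nat_into T) = T"
    by (intro range_from_nat_into) auto
  define \<alpha> \<beta> c where "\<alpha> s = fst (from_nat_into T s)" and "\<beta> s = fst (snd (from_nat_into T s))"
    and "c s = snd (snd (from_nat_into T s))" for s
  have "from_nat_into T s \<in> T" for s using T by blast
  then have \<alpha>\<beta>: "\<alpha> s < \<beta> s" and c: "c s \<in> {1..k + 3}" for s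
    by (force simp: T_def \<alpha>_def \<beta>_def c_def split_def)+
  have dense: "\<exists>s. a < \<alpha> s \<and> \<beta> s < b \<and> c s = i" if "a < b" "i \<in> {1..k + 3}" for a b i
  proof -
    obtain p where p: "p \<in> \<rat>" "a < p" "p < b"
      using Rats_dense_in_real[OF \<open>a < b\<close>] by blast
    obtain q where q: "q \<in> \<rat>" "p < q" "q < b"
      using Rats_dense_in_real[OF \<open>p < b\<close>] by blast
    from p q have "(p, q, i) \<in> T" using that by (simp add: T_def)
    then obtain s where "from_nat_into T s = (p, q, i)" using T by (metis imageE)
    then show ?thesis using \<open>a < p\<close> \<open>q < b\<close> by (auto simp: \<alpha>_def \<beta>_def c_def intro!: exI[of _ s])
  qed
  obtain P :: "nat \<Rightarrow> real set" and u v :: "nat \<Rightarrow> real" where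
    finP: "\<And>n. finite (P n)" and uv: "\<And>n. \<alpha> n < u n" "\<And>n. u n < v n" "\<And>n. v n < \<beta> n"
    and P_Suc: "\<And>n. P (Suc n) = P n \<union> {u n, v n}"
    and decay: "\<And>n. v (Suc n) - u (Suc n) \<le> (v n - u n) / 4"
    and gap: "\<And>n. combination_gap (P n) (4 * (v n - u n))"
    by (rule breakpoint_sequence[of \<alpha> \<beta>, OF \<alpha>\<beta>]) (rule that)
  have inP: "u s \<in> P n \<and> v s \<in> P n" if "s < n" for s n
    using that by (induction n) (auto simp: P_Suc less_Suc_eq)
  \<comment> \<open>Half-open like the cells of \<open>step_on\<close>: membership in
    \<open>J s\<close> depends only on the comparisons of \<open>u s\<close> and \<open>v s\<close>
    with the point.\<close>
  define J where "J s = {u s..<v s}" for s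
  \<comment> \<open>Emptying the stages from \<open>n\<close> on, instead of dropping them, lets one
    definition of \<open>last_color\<close> give both \<open>f\<close> and the step coloring
    \<open>g n\<close>; they can differ only on \<open>E n\<close>.\<close>
  define JS where "JS n s = (if s < n then J s else {})" for n s
  define E where "E n = (\<Union>t\<in>{n..}. J t)" for n
  define f where "f = last_color J c"
  define g where "g n = last_color (JS n) c" for n
  have E: "E n \<in> lmeasurable" "measure lebesgue (E n) \<le> 4 / 3 * (v n - u n)" for n
    using geometric_tail_measure[of u v n, OF uv(2) decay] by (simp_all add: E_def J_def)
  have f: "measurable_coloring (k + 3) f"
    unfolding f_def using c by (intro measurable_coloring_last_color) (auto simp: J_def)
  have g: "measurable_coloring (k + 3) (g n)" for n
    unfolding g_def using c by (intro measurable_coloring_last_color) (auto simp: J_def JS_def)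
  have step: "step_on (P n) (g n)" for n
    unfolding step_on_def
  proof (intro allI impI)
    fix x y assume xy: "\<forall>p\<in>P n. (p \<le> x) = (p \<le> y)"
    have "x \<in> JS n s \<longleftrightarrow> y \<in> JS n s" for s
      using inP[of s n] xy by (auto simp: JS_def J_def not_le[symmetric] simp del: not_le)
    then show "g n x = g n y" unfolding g_def by (rule last_color_cong)
  qed
  have fg: "f x = g n x" if "x \<notin> E n" for x n
  proof -
    have "x \<in> J s \<longleftrightarrow> x \<in> JS n s" for s
      using that by (auto simp: JS_def E_def)
    then show ?thesis unfolding f_def g_def by (rule last_color_cong)
  qed
  have "\<not> has_splitting (k + 3) f a b r" if "a < b" "r \<le> k" for a b r
  proof
    assume "has_splitting (k + 3) f a b r"
    then obtain y where sp: "is_splitting (k + 3) f a b r y"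
      unfolding has_splitting_def ..
    then have y: "y 0 = a" "y (r + 1) = b" "\<And>i. i \<le> r \<Longrightarrow> y i < y (i + 1)"
      by (simp_all add: is_splitting_def)
    from sp obtain F1 F2 where fp: "fair_partition (k + 3) f {{y i..y (i + 1)} |i. i \<le> r} F1 F2"
      unfolding is_splitting_def by (elim conjE exE)
    then have F: "F1 \<union> F2 = {{y i..y (i + 1)} |i. i \<le> r}" "F1 \<inter> F2 = {}"
      and fair: "\<And>i. i \<in> {1..k + 3} \<Longrightarrow> color_measure f i (\<Union>F1) = color_measure f i (\<Union>F2)"
      by (simp_all only: fair_partition_def)
    define Y where "Y = y ` {..r + 1}"
    have Y: "finite Y" "card Y < k + 3"
      using card_image_le[of "{..r + 1}" y] \<open>r \<le> k\<close> by (auto simp: Y_def)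
    have FY: "\<exists>u\<in>Y. \<exists>v\<in>Y. I = {u..v}" if "I \<in> F1 \<union> F2" for I
      using that unfolding F(1) by (force simp: Y_def)
    have mono: "y p \<le> y q" if "p \<le> q" "q \<le> r + 1" for p q
      using that
    proof (induction q rule: dec_induct)
      case (step q)
      then show ?case using y(3)[of q] by simp
    qed simp
    obtain s where s: "\<And>i. i \<in> {1..k + 3} \<Longrightarrow> a < \<alpha> (s i) \<and> \<beta> (s i) < b \<and> c (s i) = i"
      using dense[OF \<open>a < b\<close>] by metis
    \<comment> \<open>The color missed by the endpoints is read off from \<open>g n\<close>, so
      \<open>n\<close> must be fixed first: it lies beyond a stage placing color \<open>i\<close>
      inside \<open>[a, b]\<close>, for every \<open>i\<close>.\<close>
    define n where "n = Suc (Max (s ` {1..k + 3}))"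
    have sn: "s i < n" if "i \<in> {1..k + 3}" for i
      using that by (auto simp: n_def less_Suc_eq_le)
    have "card (g n ` Y) < card {1..k + 3}"
      using Y card_image_le[OF Y(1), of "g n"] by simp
    then have "\<not> {1..k + 3} \<subseteq> g n ` Y"
      using card_mono[of "g n ` Y" "{1..k + 3}"] Y(1) by auto
    then obtain i where i: "i \<in> {1..k + 3}" "i \<notin> g n ` Y" by blast
    define t where "t = s i"
    have t: "a < u t" "v t < b" "c t = i" "t < n"
      using s[OF i(1)] uv(1,3)[of t] sn[OF i(1)] by (auto simp: t_def)
    \<comment> \<open>Later intervals have measure at most 4/3 * 1/4 = 1/3 of the length of
      \<open>J t\<close>, and \<open>Y\<close> is a null set. So some point of \<open>J t\<close> is
      not recolored after stage \<open>t\<close> and is no endpoint.\<close>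
    have "\<not> J t \<subseteq> E (Suc t) \<union> Y"
    proof
      assume sub: "J t \<subseteq> E (Suc t) \<union> Y"
      have Ym: "Y \<in> lmeasurable" "measure lebesgue Y = 0"
        using negligible_imp_measurable negligible_imp_measure0 negligible_finite Y(1) by blast+
      have "v t - u t = measure lebesgue (J t)"
        using uv(2)[of t] by (simp add: J_def)
      also have "\<dots> \<le> measure lebesgue (E (Suc t) \<union> Y)"
        using sub E(1) Ym(1) by (intro measure_mono_fmeasurable) (auto simp: J_def)
      also have "\<dots> \<le> measure lebesgue (E (Suc t)) + measure lebesgue Y"
        using E(1) Ym(1) by (intro measure_Un_le) auto
      also have "\<dots> \<le> (v t - u t) / 3"
        using E(2)[of "Suc t"] decay[of t] Ym(2) by simp
      finally show False using uv(2)[of t] by simp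
    qed
    then obtain x where x: "x \<in> J t" "x \<notin> E (Suc t)" "x \<notin> Y" by blast
    have gx: "g n x = i"
      unfolding g_def t(3)[symmetric] using x t(4)
      by (intro last_color_eq) (auto simp: JS_def E_def)
    have "x \<in> \<Union>(F1 \<union> F2)"
    proof -
      have "y 0 \<le> x" "x \<le> y (Suc r)" using x(1) t y(1,2) by (auto simp: J_def)
      then obtain p where "p \<le> r" "y p \<le> x" "x \<le> y (Suc p)"
        using point_in_consecutive by blast
      then show ?thesis unfolding F(1) by force
    qed
    \<comment> \<open>Distinct intervals of the splitting meet at most in a point of
      \<open>Y\<close>, which \<open>x\<close> avoids.\<close>
    moreover have "\<not> (x \<in> \<Union>F1 \<and> x \<in> \<Union>F2)"
    proof
      assume "x \<in> \<Union>F1 \<and> x \<in> \<Union>F2"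
      then obtain I1 I2 where I: "I1 \<in> F1" "I2 \<in> F2" "x \<in> I1" "x \<in> I2" by blast
      then have "I1 \<in> F1 \<union> F2" "I2 \<in> F1 \<union> F2" by auto
      then obtain p q where pq: "p \<le> r" "q \<le> r" "I1 = {y p..y (p + 1)}" "I2 = {y q..y (q + 1)}"
        unfolding F(1) by blast
      have "p \<noteq> q" using I F(2) pq by blast
      then consider "p + 1 \<le> q" | "q + 1 \<le> p" by linarith
      then have "x = y p \<or> x = y q"
        using mono[of "p + 1" q] mono[of "q + 1" p] I pq by cases force+
      then show False using x(3) pq by (auto simp: Y_def)
    qed
    ultimately have "x \<in> \<Union>F1 \<longleftrightarrow> x \<notin> \<Union>F2" by blast
    then have lower: "4 * (v n - u n) \<le>
        \<bar>color_measure (g n) i (\<Union>F1) - color_measure (g n) i (\<Union>F2)\<bar>"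
      using imbalance_lower_bound[OF finP step gap Y(1) FY i(2) gx] by blast
    \<comment> \<open>The error is at most the measure of \<open>E n\<close>, hence at most 4/3 of
      the length of stage \<open>n\<close>.\<close>
    have close: "\<bar>color_measure f i (\<Union>F) - color_measure (g n) i (\<Union>F)\<bar> < 2 * (v n - u n)"
      if "F \<subseteq> F1 \<union> F2" for F
    proof -
      have "finite (F1 \<union> F2)" unfolding F(1) by simp
      then have "finite F" using that finite_subset by blast
      then have U: "\<Union>F \<in> lmeasurable"
        using that FY by (intro fmeasurable.finite_Union) (auto intro: bounded_set_imp_lmeasurable)
      have inter: "h -` {i} \<inter> \<Union>F \<in> lmeasurable" if "measurable_coloring (k + 3) h" for h
        using that i(1) by (intro fmeasurable_Int_fmeasurable[OF U, simplified Int_commute])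
          (auto simp: measurable_coloring_def)
      have "\<bar>color_measure f i (\<Union>F) - color_measure (g n) i (\<Union>F)\<bar> \<le> measure lebesgue (E n)"
        unfolding color_measure_def using fg
        by (intro measure_diff_le_of_eq_off inter f g E(1)) auto
      also have "\<dots> \<le> 4 / 3 * (v n - u n)" by (rule E(2))
      also have "\<dots> < 2 * (v n - u n)" using uv(2)[of n] by simp
      finally show ?thesis .
    qed
    \<comment> \<open>Fairness for \<open>f\<close> leaves \<open>g n\<close> an imbalance below 2 +
      2 times \<open>v n - u n\<close>, against \<open>lower\<close>.\<close>
    show False
      using lower close[OF Un_upper1] close[OF Un_upper2] fair[OF i(1)] by linarith
  qed
  then show ?thesis using f by blast
qed

end
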